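(* Fix an absolute constant $C>0$. There exists a constant $C_1>0$ (absolute, i.e. depending only on $C$) such that the following holds. Let $\mathbf{A}\in\mathbb{R}^{m\times n}$ have rows $\mathbf{a}_1,\dots,\mathbf{a}_m\in\mathbb{S}^{n-1}$ and satisfy $$\frac{\sigma_{\max}(\mathbf{A})\sqrt n}{\sqrt m\,\sqrt{1-q'}}\le\frac{C}{\sqrt{1-q'}}\qquad\text{for all } q'\in(0,1).$$ Let $\beta\in(0,1)$, and let $\mathbf{b}=\mathbf{A}\mathbf{x}^*+\boldsymbol\epsilon$ with $\mathbf{x}^*\in\mathbb{R}^n$ and $\boldsymbol\epsilon\in\mathbb{R}^m$ an arbitrary $(\beta m)$-sparse vector; put $B=\{i:\epsilon_i\ne0\}$. Let $q\in(0,1)$, $\mathbf{x}_0\in\mathbb{R}^n$, and let the number of iterations $T$ satisfy $T\ge\lceil\frac{n}{\log n}\rceil$. For any $c_0\in(0,1)$, if the subsample size $D$ is a positive integer with $$D\le\max\Big\{\frac{c_0\log T}{\log(2/\beta)},\,1\Big\},$$ then the iterate $\mathbf{X}_T$ after $T$ steps of QuantileRK($q$) with subsample size $D$ started from $\mathbf{x}_0$ satisfies, with probability at least $$1-\frac{C_1}{\log n}-\exp\Big(-\frac{\beta^2n}{4\log n}\Big)-\exp\Big(-\frac{\beta}{2}\,\frac{n}{T^{c_0}\log n}\Big),$$ the bound $$\|\mathbf{X}_T-\mathbf{x}^*\|^2\ \ge\ (0.99)^{\lfloor\frac{n}{\log n}\rfloor}\,\min_{i\in B}|\epsilon_i|^2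 .$$
   Context: Notation: $[m]=\{1,\dots,m\}$; $\|\cdot\|$ is the Euclidean norm; $\log$ is the natural logarithm ($n\ge2$ is understood, so that $n/\log n$ is defined); $\mathbb{S}^{n-1}$ is the Euclidean unit sphere of $\mathbb{R}^n$; $\sigma_{\max}(\mathbf{A})$ is the largest singular value. A vector is $s$-sparse if it has at most $s$ nonzero entries (with arbitrary values). The number $\beta m$ is assumed to be a positive integer. Quantile: for a multiset $\{z_1,\dots,z_N\}$ with nondecreasing rearrangement $z_1^*\le\dots\le z_N^*$, the $q$-quantile is $z^*_{\lfloor qN\rfloor}$ (and $z_1^*$ if $qN<1$). Algorithm QuantileRK($q$) with subsample size $D$ (rows of $\mathbf{A}$ have unit norm): start from the deterministic $\mathbf{X}_0=\mathbf{x}_0$. At step $k=0,1,\dots,T-1$, draw indices $i_1^{(k+1)},\dots,i_D^{(k+1)}$ (the quantile subsample) and $r_{k+1}$ (the update sample), all independent of one another and of the past and uniformly distributed on $[m]$. Put $h=\mathbf{a}_{r_{k+1}}^\top\mathbf{X}_k-b_{r_{k+1}}$. If $|h|$ is at most the $q$-quantile of the multiset $\{|\mathbf{a}_{i_j^{(k+1)}}^\top\mathbf{X}_k-b_{i_j^{(k+1)}}|\}_{j=1}^D$, set $\mathbf{X}_{k+1}=\mathbf{X}_k-h\,\mathbf{a}_{r_{k+1}}$; otherwise set $\mathbf{X}_{k+1}=\mathbf{X}_k$. The matrix $\mathbf{A}$, $\mathbf{x}^*$ and $\boldsymbol\epsilon$ are fixed; probability is over the algorithm's random samples.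
   Formalization: The formal theorem assumes that ε has exactly βm nonzero entries, |B| = βm, not merely at most βm; with fewer the claim fails, e.g. if B is empty (no minimum) or if a single corrupted row among very many is almost surely never sampled. *)

theory Defs
  imports
    "HOL-Probability.Probability"
    "Jordan_Normal_Form.Char_Poly"
begin

text \<open>
  Vectors and matrices are those of \<^theory>\<open>Jordan_Normal_Form.Matrix\<close>, whose dimensions are natural
  numbers rather than types: a constant that must be independent of the dimensions can then be
  quantified outside them. Row and coordinate indices therefore run over \<open>{..<m}\<close>, in place of
  \<open>{1, ..., m}\<close>.
\<close>

unbundle no vec_syntax
unbundle no inner_syntax

definition l2_norm :: "real vec \<Rightarrow> real" where
  "l2_norm v = sqrt (v \<bullet> v)"

text \<open>
  The squares of the singular values are the eigenvalues of the Gram matrix. If the matrix has more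
  columns than rows this adds extra values 0 to the set, which does not affect the maximum.
\<close>
definition sigma_max :: "real mat \<Rightarrow> real" where
  "sigma_max A = Max {sqrt l | l. eigenvalue (transpose_mat A * A) l}"

definition supp :: "real vec \<Rightarrow> nat set" where
  "supp v = {i. i < dim_vec v \<and> v $ i \<noteq> 0}"

text \<open>
  Sparsity is only an upper bound on the support. A lower bound for the error in terms of the
  smallest nonzero entry fails for supports that are much too small (with high probability never sampled), or
  empty; the theorem therefore also assumes that the support has at least \<open>s\<close> elements.
\<close>
definition sparse :: "nat \<Rightarrow> real vec \<Rightarrow> bool" where
  "sparse s v \<longleftrightarrow> card (supp v) \<le> s"

text \<open>The list is indexed from 0, so the \<open>k\<close>-th smallest element is at position \<open>k - 1\<close>.\<close>
definition quantile :: "real \<Rightarrow> real multiset \<Rightarrow> real" where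
  "quantile q Z =
     (let N = real (size Z); k = (if q * N < 1 then 1 else nat \<lfloor>q * N\<rfloor>)
      in sorted_list_of_multiset Z ! (k - 1))"

definition residual :: "real mat \<Rightarrow> real vec \<Rightarrow> real vec \<Rightarrow> nat \<Rightarrow> real" where
  "residual A b x i = row A i \<bullet> x - b $ i"

definition qrk_step :: "real mat \<Rightarrow> real vec \<Rightarrow> real \<Rightarrow> real vec \<Rightarrow> nat list \<Rightarrow> nat \<Rightarrow> real vec" where
  "qrk_step A b q x is r =
     (let h = residual A b x r
      in if \<bar>h\<bar> \<le> quantile q (image_mset (\<lambda>i. \<bar>residual A b x i\<bar>) (mset is))
         then x - h \<cdot>\<^sub>v row A r else x)"

text \<open>
  The law of the iterate after the given number of steps. The samples of a step are drawn afresh, so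
  they are independent of each other and of the past; \<^const>\<open>replicate_pmf\<close> is the law of a list of
  independent draws (with replacement).
\<close>
primrec quantile_rk ::
  "real mat \<Rightarrow> real vec \<Rightarrow> real \<Rightarrow> nat \<Rightarrow> real vec \<Rightarrow> nat \<Rightarrow> real vec pmf" where
  "quantile_rk A b q D x0 0 = return_pmf x0"
| "quantile_rk A b q D x0 (Suc k) =
     do {
       x \<leftarrow> quantile_rk A b q D x0 k;
       is \<leftarrow> replicate_pmf D (pmf_of_set {..<dim_row A});
       r \<leftarrow> pmf_of_set {..<dim_row A};
       return_pmf (qrk_step A b q x is r)
     }"

end

theory Submission
  imports Defs
begin

text \<open>
  An update by row \<open>i\<close> changes the squared error \<open>\<parallel>e\<parallel>\<^sup>2\<close> to \<open>\<parallel>e\<parallel>\<^sup>2 - (a\<^sub>i \<bullet> e)\<^sup>2 + \<epsilon>\<^sub>i\<^sup>2\<close>, which is at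
  least \<open>\<epsilon>\<^sub>i\<^sup>2\<close>. As \<open>\<parallel>A e\<parallel>\<^sup>2 \<le> C\<^sup>2 (m/n) \<parallel>e\<parallel>\<^sup>2\<close>, by Markov's inequality at most a fraction \<open>100 C\<^sup>2/n\<close> of the
  rows can remove more than one percent of the squared error. On the other hand each step uses a
  corrupted row with probability at least \<open>\<beta>\<^sup>D\<^sup>+\<^sup>1/(D+1)\<close>: all samples are corrupted and the update row has
  the smallest residual among them. Let \<open>b\<^sub>k\<close> be the probability that, \<open>k\<close> steps into the last
  \<open>N = \<lfloor>n / log n\<rfloor>\<close> steps, the squared error is below \<open>0.99\<^sup>k min \<epsilon>\<^sub>i\<^sup>2\<close>. Then
  \<open>b\<^sub>k\<^sub>+\<^sub>1 \<le> (1 - p) b\<^sub>k + 100 C\<^sup>2/n\<close> with \<open>p = \<beta>\<^sup>D\<^sup>+\<^sup>1/(D+1)\<close>, hence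
  \<open>b\<^sub>N \<le> (1 - p)\<^sup>N + 100 C\<^sup>2/log n\<close>.
\<close>

section \<open>The largest singular value as an operator norm\<close>

lemma scalar_prod_self_nonneg: "0 \<le> (v :: real vec) \<bullet> v"
  by (simp add: scalar_prod_def sum_nonneg)

lemma scalar_prod_self_eq_0_iff:
  fixes v :: "real vec"
  assumes "v \<in> carrier_vec n"
  shows "v \<bullet> v = 0 \<longleftrightarrow> v = 0\<^sub>v n"
  using conjugate_square_eq_0_vec[OF assms] by (simp add: conjugate_real_def conjugate_vec_def vec_eq_iff)

lemma l2_norm_sq: "(l2_norm v)\<^sup>2 = v \<bullet> v"
  by (simp add: l2_norm_def scalar_prod_self_nonneg)

text \<open>Coding vectors as functions that vanish from \<open>n\<close> on gives them the product
  topology, in which the sphere is a closed subset of a box that is compact by Tychonoff.\<close>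

lemma compact_unit_sphere_fun:
  "compact {f :: nat \<Rightarrow> real. (\<forall>i\<ge>n. f i = 0) \<and> (\<Sum>i<n. (f i)\<^sup>2) = 1}" (is "compact ?S")
proof -
  let ?K = "PiE UNIV (\<lambda>i. if i < n then {-1..1} else {0 :: real})"
  have K: "compact ?K"
    unfolding compactin_euclidean_iff[symmetric] euclidean_product_topology[symmetric]
    by (subst compactin_PiE) auto
  have "closed {f :: nat \<Rightarrow> real. (\<Sum>i<n. (f i)\<^sup>2) = 1}"
    by (intro closed_Collect_eq continuous_intros continuous_on_product_coordinates)
  with K have "compact (?K \<inter> {f. (\<Sum>i<n. (f i)\<^sup>2) = 1})"
    by (rule compact_Int_closed)
  moreover have "?K \<inter> {f. (\<Sum>i<n. (f i)\<^sup>2) = 1} = ?S"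
  proof (intro equalityI subsetI)
    fix f assume f: "f \<in> ?S"
    have "(f i)\<^sup>2 \<le> 1" if "i < n" for i
      using f member_le_sum[of i "{..<n}" "\<lambda>i. (f i)\<^sup>2"] that by auto
    hence "\<bar>f i\<bar> \<le> 1" if "i < n" for i
      using that by (simp add: abs_square_le_1)
    thus "f \<in> ?K \<inter> {f. (\<Sum>i<n. (f i)\<^sup>2) = 1}"
      using f by (force simp: PiE_def Pi_def abs_le_iff)
  next
    fix f assume f: "f \<in> ?K \<inter> {f. (\<Sum>i<n. (f i)\<^sup>2) = 1}"
    have "f i = 0" if "i \<ge> n" for i
    proof -
      have "f i \<in> (if i < n then {-1..1} else {0})" using f by (auto simp: PiE_def Pi_def)
      thus ?thesis using that by simp
    qed
    thus "f \<in> ?S" using f by auto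
  qed
  ultimately show ?thesis by simp
qed

text \<open>The form is continuous, so it attains its maximum on the compact sphere; being
  homogeneous of degree two, it obeys the bound at every \<open>w\<close> after rescaling.\<close>

lemma quadratic_form_max:
  fixes A :: "real mat"
  assumes A: "A \<in> carrier_mat m n" and n: "0 < n"
  obtains v where "v \<in> carrier_vec n" "v \<bullet> v = 1"
    "\<And>w. w \<in> carrier_vec n \<Longrightarrow> (A *\<^sub>v w) \<bullet> (A *\<^sub>v w) \<le> ((A *\<^sub>v v) \<bullet> (A *\<^sub>v v)) * (w \<bullet> w)"
proof -
  define S where "S = {f :: nat \<Rightarrow> real. (\<forall>i\<ge>n. f i = 0) \<and> (\<Sum>i<n. (f i)\<^sup>2) = 1}"
  define Q :: "(nat \<Rightarrow> real) \<Rightarrow> real" where "Q f = (\<Sum>i<m. (\<Sum>j<n. A $$ (i, j) * f j)\<^sup>2)" for f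
  define q where "q w = (A *\<^sub>v w) \<bullet> (A *\<^sub>v w)" for w
  have Qq: "q w = Q (\<lambda>i. w $ i)" if "w \<in> carrier_vec n" for w
    using A that unfolding q_def Q_def scalar_prod_def
    by (auto simp: power2_eq_square scalar_prod_def lessThan_atLeast0 intro!: sum.cong)
  have sq: "w \<bullet> w = (\<Sum>i<n. (w $ i)\<^sup>2)" if "w \<in> carrier_vec n" for w :: "real vec"
    using that by (auto simp: scalar_prod_def power2_eq_square lessThan_atLeast0)
  have "(\<lambda>i. if i = 0 then 1 else 0) \<in> S"
    using n by (auto simp: S_def if_distrib[of "\<lambda>x. x\<^sup>2"] cong: if_cong)
  hence ne: "S \<noteq> {}" by blast
  have cont: "continuous_on S Q"
    unfolding Q_def
    by (intro continuous_intros continuous_on_subset[OF continuous_on_product_coordinates]) auto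
  have "compact S" unfolding S_def by (rule compact_unit_sphere_fun)
  then obtain f where f: "f \<in> S" "\<And>g. g \<in> S \<Longrightarrow> Q g \<le> Q f"
    using continuous_attains_sup[OF _ ne cont] by blast
  define v where "v = vec n f"
  have Qv: "q v = Q f" by (subst Qq) (auto simp: v_def Q_def)
  show thesis
  proof
    show "v \<in> carrier_vec n" by (simp add: v_def)
    show "v \<bullet> v = 1" using f(1) by (subst sq) (auto simp: v_def S_def)
    fix w :: "real vec" assume w: "w \<in> carrier_vec n"
    show "(A *\<^sub>v w) \<bullet> (A *\<^sub>v w) \<le> ((A *\<^sub>v v) \<bullet> (A *\<^sub>v v)) * (w \<bullet> w)"
    proof (cases "w \<bullet> w = 0")
      case True
      hence "w = 0\<^sub>v n" using scalar_prod_self_eq_0_iff[OF w] by blast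
      thus ?thesis using A by (simp add: scalar_prod_def)
    next
      case False
      define N where "N = w \<bullet> w"
      have N: "N > 0" using False scalar_prod_self_nonneg[of w] by (simp add: N_def)
      define g where "g = (\<lambda>i. if i < n then w $ i / sqrt N else 0)"
      have "(\<Sum>i<n. (g i)\<^sup>2) = (\<Sum>i<n. (w $ i)\<^sup>2) / N"
        using N by (simp add: g_def power_divide sum_divide_distrib)
      also have "\<dots> = 1" using N by (simp add: sq[OF w, symmetric] N_def[symmetric])
      finally have "g \<in> S" by (auto simp: g_def S_def)
      hence "Q g \<le> Q f" by (rule f(2))
      moreover have "Q g = Q (\<lambda>i. w $ i) / N"
      proof -
        have eq: "(\<Sum>j<n. A $$ (i, j) * g j) = (\<Sum>j<n. A $$ (i, j) * w $ j) / sqrt N" for i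
          by (simp add: g_def sum_divide_distrib)
        have "Q g = (\<Sum>i<m. (\<Sum>j<n. A $$ (i, j) * w $ j)\<^sup>2 / N)"
          unfolding Q_def eq using N by (simp add: power_divide)
        thus ?thesis by (simp add: Q_def sum_divide_distrib)
      qed
      ultimately show ?thesis
        using N Qv Qq[OF w] by (simp add: q_def N_def divide_le_eq)
    qed
  qed
qed

lemma linear_coeff_zero:
  fixes a c :: real
  assumes "\<And>t. 0 \<le> 2 * t * a + t\<^sup>2 * c"
  shows "a = 0"
proof -
  define d where "d = \<bar>c\<bar> + 1"
  have d: "d > 0" "c < d" by (auto simp: d_def)
  \<comment> \<open>As \<open>c < d\<close>, the linear term dominates at
    \<open>t = - a / d\<close>, and the value is negative unless \<open>a = 0\<close>.\<close>
  have "0 \<le> 2 * (- a / d) * a + (- a / d)\<^sup>2 * c" by (rule assms)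
  also have "\<dots> = (a\<^sup>2 / d\<^sup>2) * (c - 2 * d)"
    using d by (simp add: field_simps power2_eq_square)
  finally have "0 \<le> (a\<^sup>2 / d\<^sup>2) * (c - 2 * d)" .
  moreover have "c - 2 * d < 0" using d by simp
  ultimately have "a\<^sup>2 / d\<^sup>2 \<le> 0" by (simp only: zero_le_mult_iff) linarith
  thus ?thesis using d by (simp add: divide_le_0_iff)
qed

text \<open>First-order optimality at a maximiser of the Rayleigh quotient.\<close>
lemma rayleigh_max_eigenvector:
  fixes A :: "real mat"
  assumes A: "A \<in> carrier_mat m n" and v: "v \<in> carrier_vec n" "v \<bullet> v = 1"
    and max: "\<And>w. w \<in> carrier_vec n \<Longrightarrow>
      (A *\<^sub>v w) \<bullet> (A *\<^sub>v w) \<le> ((A *\<^sub>v v) \<bullet> (A *\<^sub>v v)) * (w \<bullet> w)"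
  shows "eigenvector (transpose_mat A * A) v ((A *\<^sub>v v) \<bullet> (A *\<^sub>v v))"
proof -
  define l where "l = (A *\<^sub>v v) \<bullet> (A *\<^sub>v v)"
  define G where "G = transpose_mat A * A"
  \<comment> \<open>The defect of the eigenvector equation. Perturbing \<open>v\<close> in this
    direction shows that it vanishes.\<close>
  define w where "w = l \<cdot>\<^sub>v v - G *\<^sub>v v"
  have G: "G \<in> carrier_mat n n" using A by (simp add: G_def)
  have w: "w \<in> carrier_vec n" using G v by (simp add: w_def)
  have Av: "A *\<^sub>v v \<in> carrier_vec m" and Aw: "A *\<^sub>v w \<in> carrier_vec m"
    using A v w by (auto intro: mult_mat_vec_carrier)
  have "(G *\<^sub>v v) \<bullet> w = (A *\<^sub>v w) \<bullet> (A *\<^sub>v v)"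
  proof -
    have "G *\<^sub>v v = transpose_mat A *\<^sub>v (A *\<^sub>v v)"
      unfolding G_def by (rule assoc_mult_mat_vec) (use A v in auto)
    moreover have "(transpose_mat A *\<^sub>v (A *\<^sub>v v)) \<bullet> w = (A *\<^sub>v v) \<bullet> (A *\<^sub>v w)"
      by (rule transpose_vec_mult_scalar) (use A w Av in auto)
    ultimately show ?thesis using comm_scalar_prod[OF Av Aw] by simp
  qed
  hence ww: "w \<bullet> w = l * (v \<bullet> w) - (A *\<^sub>v v) \<bullet> (A *\<^sub>v w)"
    using v w G comm_scalar_prod[OF Av Aw]
    by (subst (1) w_def) (simp add: minus_scalar_prod_distrib[of _ n])
  \<comment> \<open>This is \<open>l * (u \<bullet> u) - (A *\<^sub>v u) \<bullet> (A *\<^sub>v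
    u)\<close> at \<open>u = v + t \<cdot>\<^sub>v w\<close>, nonnegative by maximality. The
    constant term cancels because \<open>v\<close> is a unit vector.\<close>
  have "0 \<le> 2 * t * (w \<bullet> w) + t\<^sup>2 * (l * (w \<bullet> w) - (A *\<^sub>v w) \<bullet> (A *\<^sub>v w))" for t
  proof -
    let ?u = "v + t \<cdot>\<^sub>v w"
    have "A *\<^sub>v ?u = A *\<^sub>v v + t \<cdot>\<^sub>v (A *\<^sub>v w)"
      using A v w by (simp add: mult_add_distrib_mat_vec[of _ m n] mult_mat_vec[of _ m n])
    hence "(A *\<^sub>v ?u) \<bullet> (A *\<^sub>v ?u) = l + 2 * t * ((A *\<^sub>v v) \<bullet> (A *\<^sub>v w)) + t\<^sup>2 * ((A *\<^sub>v w) \<bullet> (A *\<^sub>v w))"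
      using Av Aw comm_scalar_prod[OF Av Aw]
      by (simp add: add_scalar_prod_distrib[of _ m] scalar_prod_add_distrib[of _ m] l_def
          power2_eq_square algebra_simps)
    moreover have "?u \<bullet> ?u = 1 + 2 * t * (v \<bullet> w) + t\<^sup>2 * (w \<bullet> w)"
      using v w comm_scalar_prod[OF v(1) w]
      by (simp add: add_scalar_prod_distrib[of _ n] scalar_prod_add_distrib[of _ n]
          power2_eq_square algebra_simps)
    moreover have "2 * t * (w \<bullet> w) = 2 * t * l * (v \<bullet> w) - 2 * t * ((A *\<^sub>v v) \<bullet> (A *\<^sub>v w))"
      by (simp add: ww algebra_simps)
    moreover have "(A *\<^sub>v ?u) \<bullet> (A *\<^sub>v ?u) \<le> l * (?u \<bullet> ?u)"
      unfolding l_def by (rule max) (use v w in simp)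
    ultimately show ?thesis by (simp add: algebra_simps)
  qed
  hence "w \<bullet> w = 0" by (rule linear_coeff_zero)
  hence "w = 0\<^sub>v n" using scalar_prod_self_eq_0_iff[OF w] by blast
  hence "(l \<cdot>\<^sub>v v - G *\<^sub>v v) $ i = 0" if "i < n" for i using that by (simp add: w_def)
  hence "G *\<^sub>v v = l \<cdot>\<^sub>v v"
    using G v by (intro eq_vecI) auto
  moreover have "v \<noteq> 0\<^sub>v n" using v(2) by auto
  ultimately show ?thesis
    using v A by (simp add: eigenvector_def l_def G_def)
qed

text \<open>The maximum \<open>l\<close> of the form on the sphere is an eigenvalue of the Gram
  matrix, so \<open>sqrt l\<close> is among the finitely many numbers whose maximum is
  \<open>sigma_max A\<close>.\<close>

lemma sigma_max_bound:
  fixes A :: "real mat"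
  assumes A: "A \<in> carrier_mat m n" and n: "0 < n" and w: "w \<in> carrier_vec n"
  shows "0 \<le> sigma_max A" "(A *\<^sub>v w) \<bullet> (A *\<^sub>v w) \<le> (sigma_max A)\<^sup>2 * (w \<bullet> w)"
proof -
  obtain v where v: "v \<in> carrier_vec n" "v \<bullet> v = 1"
    "\<And>w. w \<in> carrier_vec n \<Longrightarrow> (A *\<^sub>v w) \<bullet> (A *\<^sub>v w) \<le> ((A *\<^sub>v v) \<bullet> (A *\<^sub>v v)) * (w \<bullet> w)"
    using quadratic_form_max[OF A n] by blast
  define l where "l = (A *\<^sub>v v) \<bullet> (A *\<^sub>v v)"
  define G where "G = transpose_mat A * A"
  have G: "G \<in> carrier_mat n n" using A by (simp add: G_def)
  have "eigenvalue G l"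
    using rayleigh_max_eigenvector[OF A v] by (auto simp: eigenvalue_def l_def G_def)
  moreover have "finite {sqrt k | k. eigenvalue G k}"
  proof -
    have "char_poly G \<noteq> 0" using degree_monic_char_poly[OF G] by auto
    hence "finite {k. eigenvalue G k}"
      using poly_roots_finite by (simp add: eigenvalue_root_char_poly[OF G])
    thus ?thesis by (simp add: setcompr_eq_image)
  qed
  ultimately have le: "sqrt l \<le> sigma_max A"
    unfolding sigma_max_def G_def[symmetric] by (intro Max_ge) auto
  have l0: "0 \<le> l" unfolding l_def by (rule scalar_prod_self_nonneg)
  thus s: "0 \<le> sigma_max A" using le real_sqrt_ge_zero[of l] by linarith
  have "l = (sqrt l)\<^sup>2" using l0 by simp
  also have "\<dots> \<le> (sigma_max A)\<^sup>2" using le l0 by (intro power_mono) auto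
  finally have "l * (w \<bullet> w) \<le> (sigma_max A)\<^sup>2 * (w \<bullet> w)"
    by (intro mult_right_mono scalar_prod_self_nonneg)
  thus "(A *\<^sub>v w) \<bullet> (A *\<^sub>v w) \<le> (sigma_max A)\<^sup>2 * (w \<bullet> w)"
    using v(3)[OF w] by (simp add: l_def)
qed

section \<open>Ranks and quantiles\<close>

text \<open>The difference of the two \<open>Suc D\<close>-th powers factors into a sum of
  \<open>Suc D\<close> terms, each at most \<open>(k + 1) ^ D\<close>. It pays for the removal of
  one element in \<open>sum_rank_power\<close>.\<close>

lemma Suc_power_le: "(k + 1) ^ Suc D \<le> Suc D * (k + 1) ^ D + k ^ Suc D" for k :: nat
proof (induction D)
  case (Suc D)
  have "(k + 1) ^ Suc (Suc D) \<le> (k + 1) * (Suc D * (k + 1) ^ D + k ^ Suc D)"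
    using Suc by (simp only: power_Suc[of _ "Suc D"]) (rule mult_left_mono, auto)
  also have "\<dots> = Suc D * (k + 1) ^ Suc D + k ^ Suc (Suc D) + k ^ Suc D"
    by (simp add: algebra_simps)
  also have "\<dots> \<le> Suc D * (k + 1) ^ Suc D + k ^ Suc (Suc D) + (k + 1) ^ Suc D"
    by (intro add_left_mono power_mono) auto
  finally show ?case by (simp add: algebra_simps)
qed simp

text \<open>
  For \<open>D + 1\<close> independent uniform draws from \<open>B\<close>, by symmetry the first one minimises \<open>g\<close> with
  probability at least \<open>1 / (D + 1)\<close>. Removing a minimiser of \<open>g\<close> from \<open>B\<close> proves this without
  the symmetry argument.
\<close>
lemma sum_rank_power:
  fixes g :: "'a \<Rightarrow> 'b :: linorder"
  assumes "finite B"
  shows "card B ^ Suc D \<le> Suc D * (\<Sum>r\<in>B. card {j \<in> B. g r \<le> g j} ^ D)"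
  using assms
proof (induction "card B" arbitrary: B)
  case (Suc k)
  hence "B \<noteq> {}" and fin: "finite B" by auto
  hence "Min (g ` B) \<in> g ` B" by simp
  then obtain r0 where r0: "r0 \<in> B" "g r0 = Min (g ` B)" by auto
  have min: "g r0 \<le> g j" if "j \<in> B" for j using r0 that fin by simp
  define B' where "B' = B - {r0}"
  have B': "finite B'" "card B' = k" "B' \<subseteq> B"
    using Suc.hyps(2) fin r0 by (auto simp: B'_def)
  have "card B ^ Suc D \<le> Suc D * card B ^ D + k ^ Suc D"
    using Suc_power_le[of k D] Suc.hyps(2) by (simp add: algebra_simps)
  also have "k ^ Suc D \<le> Suc D * (\<Sum>r\<in>B'. card {j \<in> B'. g r \<le> g j} ^ D)"
    using Suc.hyps(1)[of B'] B' by simp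
  also have "\<dots> \<le> Suc D * (\<Sum>r\<in>B'. card {j \<in> B. g r \<le> g j} ^ D)"
    using B' fin by (intro mult_left_mono sum_mono power_mono card_mono) auto
  finally have "card B ^ Suc D
      \<le> Suc D * (card B ^ D + (\<Sum>r\<in>B'. card {j \<in> B. g r \<le> g j} ^ D))"
    by (simp add: algebra_simps)
  also have "card B ^ D + (\<Sum>r\<in>B'. card {j \<in> B. g r \<le> g j} ^ D)
      = (\<Sum>r\<in>B. card {j \<in> B. g r \<le> g j} ^ D)"
  proof -
    have "{j \<in> B. g r0 \<le> g j} = B" using min by auto
    thus ?thesis
      unfolding B'_def
      using sum.remove[OF fin r0(1), of "\<lambda>r. card {j \<in> B. g r \<le> g j} ^ D"] by simp
  qed
  finally show ?case .
qed simp

text \<open>Membership is the only property of the quantile that the argument uses: a residual not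
  exceeding any sampled one is then accepted for every \<open>q\<close>.\<close>

lemma quantile_in_mset:
  assumes q: "0 < q" "q < 1" and Z: "Z \<noteq> {#}"
  shows "quantile q Z \<in># Z"
proof -
  define k where "k = (if q * real (size Z) < 1 then 1 else nat \<lfloor>q * real (size Z)\<rfloor>)"
  have N: "size Z > 0" using Z by (simp add: nonempty_has_size)
  have "k - 1 < size Z"
  proof (cases "q * real (size Z) < 1")
    case False
    have "q * real (size Z) < real (size Z)" using q N by simp
    hence "k < size Z" using False by (simp add: k_def) linarith
    thus ?thesis by simp
  qed (use N in \<open>simp add: k_def\<close>)
  moreover have "length (sorted_list_of_multiset Z) = size Z"
    by (metis mset_sorted_list_of_multiset size_mset)
  ultimately have "sorted_list_of_multiset Z ! (k - 1) \<in> set (sorted_list_of_multiset Z)"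
    by (intro nth_mem) simp
  thus ?thesis by (simp add: quantile_def Let_def k_def)
qed

section \<open>Probabilities under composed random draws\<close>

lemma prob_bind_pmf:
  "measure_pmf.prob (bind_pmf M f) X = (\<integral>x. measure_pmf.prob (f x) X \<partial>measure_pmf M)"
  unfolding measure_pmf_bind
  by (rule measure_pmf.measure_bind[of _ _ "count_space UNIV"]) (auto simp: space_subprob_algebra
      intro!: measure_pmf.subprob_space_axioms)

lemma prob_replicate_pmf_subset:
  fixes p :: "'a :: countable pmf"
  shows "measure_pmf.prob (replicate_pmf D p) {xs. set xs \<subseteq> S \<and> length xs = D} = measure_pmf.prob p S ^ D"
proof (induction D)
  case (Suc D)
  have "replicate_pmf (Suc D) p = map_pmf (\<lambda>(x, xs). x # xs) (pair_pmf p (replicate_pmf D p))"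
    by (simp add: pair_pmf_def map_bind_pmf)
  moreover have "(\<lambda>(x, xs). x # xs) -` {xs. set xs \<subseteq> S \<and> length xs = Suc D}
      = S \<times> {xs. set xs \<subseteq> S \<and> length xs = D}"
    by auto
  ultimately show ?case by (simp add: Suc measure_pmf_prob_product)
qed simp

text \<open>One transition between bad states (\<open>E\<close>, then \<open>E'\<close>) and good
  ones, obtained by integrating the pointwise bound \<open>(1 - p) * indicator E x + d\<close>. The
  two bad sets differ because the error threshold falls with every step.\<close>

lemma prob_bind_two_state:
  assumes stay: "\<And>x. x \<in> set_pmf M \<Longrightarrow> x \<in> E \<Longrightarrow> measure_pmf.prob (f x) E' \<le> 1 - p"
    and enter: "\<And>x. x \<in> set_pmf M \<Longrightarrow> x \<notin> E \<Longrightarrow> measure_pmf.prob (f x) E' \<le> d"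
    and d: "0 \<le> d"
  shows "measure_pmf.prob (bind_pmf M f) E' \<le> (1 - p) * measure_pmf.prob M E + d"
proof -
  have ind: "integrable (measure_pmf M) (indicator E :: _ \<Rightarrow> real)"
    by (rule measure_pmf.integrable_const_bound[where B = 1]) auto
  have "measure_pmf.prob (bind_pmf M f) E' = (\<integral>x. measure_pmf.prob (f x) E' \<partial>measure_pmf M)"
    by (rule prob_bind_pmf)
  also have "\<dots> \<le> (\<integral>x. (1 - p) * indicator E x + d \<partial>measure_pmf M)"
  proof (rule integral_mono_AE)
    show "integrable (measure_pmf M) (\<lambda>x. measure_pmf.prob (f x) E')"
      by (rule measure_pmf.integrable_const_bound[where B = 1]) auto
    show "AE x in measure_pmf M. measure_pmf.prob (f x) E' \<le> (1 - p) * indicator E x + d"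
      using stay enter d by (intro AE_pmfI) (fastforce simp: indicator_def)
  qed (use ind in simp)
  also have "\<dots> = (1 - p) * measure_pmf.prob M E + d" using ind by simp
  finally show ?thesis .
qed

section \<open>Geometry of a single update\<close>

locale noisy_system =
  fixes A :: "real mat" and m n :: nat and xstar \<epsilon> b :: "real vec"
  assumes A: "A \<in> carrier_mat m n"
    and unit_rows: "\<And>i. i < m \<Longrightarrow> l2_norm (row A i) = 1"
    and xstar: "xstar \<in> carrier_vec n"
    and eps: "\<epsilon> \<in> carrier_vec m"
    and b: "b = A *\<^sub>v xstar + \<epsilon>"
    and m: "0 < m" and n: "0 < n"
begin

definition sq_error :: "real vec \<Rightarrow> real" where
  "sq_error x = (x - xstar) \<bullet> (x - xstar)"

lemma row_carrier: "row A i \<in> carrier_vec n"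
  using A by auto

lemma row_row: "i < m \<Longrightarrow> row A i \<bullet> row A i = 1"
  using unit_rows[of i] l2_norm_sq[of "row A i"] by simp

lemma minus_smult_sq:
  assumes i: "i < m" and e: "e \<in> carrier_vec n"
  shows "(e - h \<cdot>\<^sub>v row A i) \<bullet> (e - h \<cdot>\<^sub>v row A i) = e \<bullet> e - 2 * h * (row A i \<bullet> e) + h\<^sup>2"
  using e row_carrier[of i] row_row[OF i] comm_scalar_prod[OF e row_carrier[of i]]
  by (simp add: minus_scalar_prod_distrib[of _ n] scalar_prod_minus_distrib[of _ n]
      power2_eq_square algebra_simps)

text \<open>Cauchy-Schwarz for a unit row: what remains of \<open>e\<close> after removing its
  projection has nonnegative squared length.\<close>

lemma row_dot_sq_le:
  assumes "i < m" and "e \<in> carrier_vec n"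
  shows "(row A i \<bullet> e)\<^sup>2 \<le> e \<bullet> e"
  using minus_smult_sq[OF assms, of "row A i \<bullet> e"]
    scalar_prod_self_nonneg[of "e - (row A i \<bullet> e) \<cdot>\<^sub>v row A i"]
  by (simp add: power2_eq_square)

lemma residual_eq:
  assumes i: "i < m" and x: "x \<in> carrier_vec n"
  shows "residual A b x i = row A i \<bullet> (x - xstar) - \<epsilon> $ i"
  using i x A xstar eps row_carrier[of i]
  by (simp add: residual_def b scalar_prod_minus_distrib[of _ n])

lemma sq_error_update:
  assumes i: "i < m" and x: "x \<in> carrier_vec n"
  shows "sq_error (x - residual A b x i \<cdot>\<^sub>v row A i)
    = sq_error x - (row A i \<bullet> (x - xstar))\<^sup>2 + (\<epsilon> $ i)\<^sup>2"
proof -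
  have "x - residual A b x i \<cdot>\<^sub>v row A i - xstar = (x - xstar) - residual A b x i \<cdot>\<^sub>v row A i"
    using x xstar A by (intro eq_vecI) auto
  moreover have "x - xstar \<in> carrier_vec n" using x xstar by simp
  ultimately show ?thesis
    unfolding sq_error_def
    by (simp only: minus_smult_sq[OF i]) (simp add: residual_eq[OF i x] power2_eq_square algebra_simps)
qed

text \<open>The update lands on the hyperplane \<open>row A i \<bullet> x = b $ i\<close>, whose
  distance from \<open>xstar\<close> is the absolute value of \<open>\<epsilon> $ i\<close>.\<close>

lemma sq_error_update_ge:
  assumes "i < m" and "x \<in> carrier_vec n"
  shows "(\<epsilon> $ i)\<^sup>2 \<le> sq_error (x - residual A b x i \<cdot>\<^sub>v row A i)"
  using sq_error_update[OF assms] row_dot_sq_le[OF assms(1), of "x - xstar"] assms xstar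
  by (simp add: sq_error_def)

lemma qrk_step_carrier:
  "x \<in> carrier_vec n \<Longrightarrow> qrk_step A b q x is r \<in> carrier_vec n"
  using row_carrier[of r] by (simp add: qrk_step_def Let_def)

section \<open>Probabilities of one random step\<close>

abbreviation rows :: "nat pmf" where
  "rows \<equiv> pmf_of_set {..<m}"

text \<open>As the image of a product law, a step turns events about the new iterate into sets of
  pairs of a subsample and an update row.\<close>

definition step_pmf :: "real \<Rightarrow> nat \<Rightarrow> real vec \<Rightarrow> real vec pmf" where
  "step_pmf q D x = map_pmf (\<lambda>(is, r). qrk_step A b q x is r) (pair_pmf (replicate_pmf D rows) rows)"

lemma quantile_rk_Suc:
  "quantile_rk A b q D x0 (Suc k) = bind_pmf (quantile_rk A b q D x0 k) (step_pmf q D)"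
  using A by (simp add: step_pmf_def[abs_def] pair_pmf_def map_bind_pmf)

lemma set_quantile_rk:
  "x0 \<in> carrier_vec n \<Longrightarrow> set_pmf (quantile_rk A b q D x0 k) \<subseteq> carrier_vec n"
proof (induction k)
  case (Suc k)
  thus ?case using qrk_step_carrier by (auto simp: set_bind_pmf)
qed simp

lemma prob_rows: "measure_pmf.prob rows S = card ({..<m} \<inter> S) / m"
  using m by (subst measure_pmf_of_set) auto

text \<open>Markov's inequality for a uniform row, since the squares
  \<open>(row A r \<bullet> e)\<^sup>2\<close> sum to at most
  \<open>(sigma_max A)\<^sup>2 * (e \<bullet> e)\<close>. Indices outside the range are put into the
  event at no cost, which lets \<open>prob_step_shrink\<close> treat all pairs alike.\<close>

lemma prob_row_aligned:
  assumes e: "e \<in> carrier_vec n" and c: "0 < c"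
  shows "measure_pmf.prob rows {r. r < m \<longrightarrow> c * (e \<bullet> e) < (row A r \<bullet> e)\<^sup>2} \<le> (sigma_max A)\<^sup>2 / (c * m)"
proof -
  define S where "S = {r. r < m \<longrightarrow> c * (e \<bullet> e) < (row A r \<bullet> e)\<^sup>2}"
  define k where "k = card ({..<m} \<inter> S)"
  have "real k * (c * (e \<bullet> e)) \<le> (sigma_max A)\<^sup>2 * (e \<bullet> e)"
  proof -
    have "real k * (c * (e \<bullet> e)) = (\<Sum>r\<in>{..<m} \<inter> S. c * (e \<bullet> e))" by (simp add: k_def)
    also have "\<dots> \<le> (\<Sum>r\<in>{..<m} \<inter> S. (row A r \<bullet> e)\<^sup>2)" by (intro sum_mono) (auto simp: S_def)
    also have "\<dots> \<le> (\<Sum>r<m. (row A r \<bullet> e)\<^sup>2)" by (intro sum_mono2) auto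
    also have "\<dots> = (A *\<^sub>v e) \<bullet> (A *\<^sub>v e)"
      using A by (auto simp: scalar_prod_def[of "A *\<^sub>v e"] power2_eq_square lessThan_atLeast0)
    also have "\<dots> \<le> (sigma_max A)\<^sup>2 * (e \<bullet> e)" by (rule sigma_max_bound(2)[OF A n e])
    finally show ?thesis .
  qed
  \<comment> \<open>Here \<open>e \<bullet> e\<close> cannot be cancelled, but the strict inequality
    in \<open>S\<close> then holds for no row.\<close>
  moreover have "k = 0" if "e \<bullet> e = 0"
  proof -
    have "(row A r \<bullet> e)\<^sup>2 \<le> 0" if "r < m" for r using row_dot_sq_le[OF that e] \<open>e \<bullet> e = 0\<close> by simp
    hence "{..<m} \<inter> S = {}" using \<open>e \<bullet> e = 0\<close> by (fastforce simp: S_def)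
    thus ?thesis by (simp add: k_def)
  qed
  ultimately have "real k * c \<le> (sigma_max A)\<^sup>2"
    using scalar_prod_self_nonneg[of e] by (cases "e \<bullet> e = 0") (auto simp: mult.assoc[symmetric])
  hence "real k / m \<le> (sigma_max A)\<^sup>2 / (c * m)" using c m by (simp add: field_simps)
  thus ?thesis by (simp add: prob_rows k_def S_def)
qed

text \<open>A rejected step keeps the error and an update with a corrupted row leaves at least
  \<open>t\<close>. So only an accepted clean row that removes more than the fraction
  \<open>c\<close> of the error can lead below the threshold. The bound ignores the
  subsample.\<close>

lemma prob_step_shrink:
  assumes x: "x \<in> carrier_vec n" and t: "0 \<le> t" "t \<le> sq_error x"
    and eps_ge: "\<And>i. i < m \<Longrightarrow> \<epsilon> $ i \<noteq> 0 \<Longrightarrow> t \<le> (\<epsilon> $ i)\<^sup>2"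
    and c: "0 < c" "c < 1"
  shows "measure_pmf.prob (step_pmf q D x) {y. sq_error y < (1 - c) * t} \<le> (sigma_max A)\<^sup>2 / (c * m)"
proof -
  define e where "e = x - xstar"
  have e: "e \<in> carrier_vec n" using x xstar by (simp add: e_def)
  define S where "S = {r. r < m \<longrightarrow> c * (e \<bullet> e) < (row A r \<bullet> e)\<^sup>2}"
  have "r \<in> S" if less: "sq_error (qrk_step A b q x is r) < (1 - c) * t" for "is" r
    unfolding S_def
  proof (intro CollectI impI)
    assume r: "r < m"
    have ct: "(1 - c) * t \<le> t" using c t by (simp add: mult_left_le_one_le)
    have "qrk_step A b q x is r \<noteq> x" using less ct t by auto
    hence step: "qrk_step A b q x is r = x - residual A b x r \<cdot>\<^sub>v row A r"
      by (auto simp: qrk_step_def Let_def split: if_splits)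
    have "\<epsilon> $ r = 0"
      using eps_ge[OF r] sq_error_update_ge[OF r x] less ct unfolding step by force
    hence "sq_error x - (row A r \<bullet> e)\<^sup>2 < (1 - c) * t"
      using less sq_error_update[OF r x] unfolding step e_def by simp
    also have "\<dots> \<le> (1 - c) * sq_error x" using c t by (intro mult_left_mono) auto
    finally show "c * (e \<bullet> e) < (row A r \<bullet> e)\<^sup>2" by (simp add: sq_error_def e_def algebra_simps)
  qed
  hence "(\<lambda>(is, r). qrk_step A b q x is r) -` {y. sq_error y < (1 - c) * t} \<subseteq> snd -` S"
    by auto
  hence "measure_pmf.prob (step_pmf q D x) {y. sq_error y < (1 - c) * t}
      \<le> measure_pmf.prob (pair_pmf (replicate_pmf D rows) rows) (snd -` S)"
    unfolding step_pmf_def measure_map_pmf by (intro measure_pmf.finite_measure_mono) auto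
  also have "\<dots> = measure_pmf.prob rows S"
    by (simp add: measure_map_pmf[symmetric] map_snd_pair_pmf del: measure_map_pmf)
  also have "\<dots> \<le> (sigma_max A)\<^sup>2 / (c * m)"
    unfolding S_def by (rule prob_row_aligned[OF e c(1)])
  finally show ?thesis .
qed

text \<open>
  If all sampled rows are corrupted and the update row minimises the residual among them, the
  update is accepted whatever \<open>q\<close> is, and it projects onto a corrupted hyperplane.
\<close>
lemma prob_step_corrupted:
  assumes x: "x \<in> carrier_vec n" and q: "0 < q" "q < 1" and D: "0 < D"
    and B: "B \<subseteq> {..<m}" and eps_ge: "\<And>i. i \<in> B \<Longrightarrow> t \<le> (\<epsilon> $ i)\<^sup>2"
  shows "(card B / m) ^ Suc D / Suc D \<le> measure_pmf.prob (step_pmf q D x) {y. t \<le> sq_error y}"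
proof -
  have finB: "finite B" using B finite_subset by blast
  define g where "g i = \<bar>residual A b x i\<bar>" for i
  define S where "S r = {j \<in> B. g r \<le> g j}" for r
  define L where "L r = {is. set is \<subseteq> S r \<and> length is = D}" for r
  define P where "P = pair_pmf (replicate_pmf D rows) rows"
  \<comment> \<open>For fixed \<open>r\<close>, a subsample in \<open>L r\<close> has only residuals
    of size at least \<open>g r\<close>, hence so is its quantile. The events are disjoint, being
    separated by \<open>r\<close>.\<close>
  have sub: "(\<Union>r\<in>B. L r \<times> {r}) \<subseteq> (\<lambda>(is, r). qrk_step A b q x is r) -` {y. t \<le> sq_error y}"
  proof (clarsimp)
    fix r "is" assume r: "r \<in> B" and "is": "is \<in> L r"
    have "mset is \<noteq> {#}" using "is" D by (auto simp: L_def)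
    hence "quantile q (image_mset g (mset is)) \<in># image_mset g (mset is)"
      by (intro quantile_in_mset[OF q]) simp
    then obtain j where "j \<in> set is" "quantile q (image_mset g (mset is)) = g j" by auto
    hence "g r \<le> quantile q (image_mset g (mset is))" using "is" by (auto simp: L_def S_def)
    hence "qrk_step A b q x is r = x - residual A b x r \<cdot>\<^sub>v row A r"
      by (simp add: qrk_step_def Let_def g_def[abs_def])
    thus "t \<le> sq_error (qrk_step A b q x is r)"
      using sq_error_update_ge[OF _ x, of r] eps_ge[OF r] r B by force
  qed
  \<comment> \<open>The event of \<open>r\<close> has probability
    \<open>(card (S r) / m) ^ D / m\<close>, so this rank sum divided by \<open>m ^ Suc D\<close> is
    the probability of the union.\<close>
  have rank: "(card B) ^ Suc D \<le> Suc D * (\<Sum>r\<in>B. card (S r) ^ D)"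
    unfolding S_def by (rule sum_rank_power[OF finB])
  have "(card B / m) ^ Suc D / Suc D = real (card B ^ Suc D) / Suc D / m ^ Suc D"
    by (simp add: power_divide)
  also have "\<dots> \<le> real (\<Sum>r\<in>B. card (S r) ^ D) / m ^ Suc D"
  proof (rule divide_right_mono)
    have "real (card B ^ Suc D) \<le> real (Suc D * (\<Sum>r\<in>B. card (S r) ^ D))"
      using rank by (rule of_nat_mono)
    thus "real (card B ^ Suc D) / Suc D \<le> real (\<Sum>r\<in>B. card (S r) ^ D)"
      by (simp only: of_nat_mult) (simp add: divide_le_eq mult.commute del: of_nat_Suc)
  qed simp
  also have "\<dots> = (\<Sum>r\<in>B. (card (S r) / m) ^ D * (1 / m))"
    by (simp add: sum_divide_distrib power_divide mult.commute)
  also have "\<dots> = (\<Sum>r\<in>B. measure_pmf.prob P (L r \<times> {r}))"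
  proof (rule sum.cong)
    fix r assume r: "r \<in> B"
    have "{..<m} \<inter> S r = S r" and "{..<m} \<inter> {r} = {r}" using r B by (auto simp: S_def)
    thus "(card (S r) / m) ^ D * (1 / m) = measure_pmf.prob P (L r \<times> {r})"
      unfolding P_def L_def
      by (subst measure_pmf_prob_product) (auto simp: prob_replicate_pmf_subset prob_rows)
  qed simp
  also have "\<dots> = measure_pmf.prob P (\<Union>r\<in>B. L r \<times> {r})"
    by (rule measure_pmf.finite_measure_finite_Union[symmetric])
      (use finB in \<open>auto simp: disjoint_family_on_def\<close>)
  also have "\<dots> \<le> measure_pmf.prob (step_pmf q D x) {y. t \<le> sq_error y}"
    unfolding step_pmf_def measure_map_pmf P_def[symmetric]
    by (rule measure_pmf.finite_measure_mono[OF sub]) simp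
  finally show ?thesis .
qed

section \<open>Iterating the one-step bounds\<close>

text \<open>Induction on \<open>N\<close> from the trivial bound 1 at time \<open>k\<close>, so the
  state reached by then is irrelevant. A corrupted update lifts the error to at least
  \<open>t\<close>, above every later threshold.\<close>

lemma prob_sq_error_small:
  fixes t c p :: real
  assumes x0: "x0 \<in> carrier_vec n" and q: "0 < q" "q < 1" and D: "0 < D"
    and t: "0 \<le> t" "\<And>i. i \<in> supp \<epsilon> \<Longrightarrow> t \<le> (\<epsilon> $ i)\<^sup>2"
    and c: "0 < c" "c < 1"
    and p: "p = (card (supp \<epsilon>) / m) ^ Suc D / Suc D"
  shows "measure_pmf.prob (quantile_rk A b q D x0 (k + N)) {x. sq_error x < (1 - c) ^ N * t}
    \<le> (1 - p) ^ N + N * ((sigma_max A)\<^sup>2 / (c * m))"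
proof -
  define d where "d = (sigma_max A)\<^sup>2 / (c * m)"
  have d: "0 \<le> d" using c by (simp add: d_def)
  have B: "supp \<epsilon> \<subseteq> {..<m}" using eps by (auto simp: supp_def)
  \<comment> \<open>\<open>p\<close> is a lower bound for a probability.\<close>
  have p1: "p \<le> 1"
    unfolding p using prob_step_corrupted[OF x0 q D B t(2)] measure_pmf.prob_le_1 order_trans by blast
  have p0: "0 \<le> p" by (simp add: p)
  show ?thesis unfolding d_def[symmetric]
  proof (induction N)
    case (Suc N)
    let ?M = "quantile_rk A b q D x0 (k + N)"
    let ?E = "{x. sq_error x < (1 - c) ^ N * t}" and ?E' = "{x. sq_error x < (1 - c) ^ Suc N * t}"
    have le: "(1 - c) ^ j * t \<le> t" for j
      using c t by (intro mult_left_le_one_le power_le_one) auto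
    have "measure_pmf.prob (bind_pmf ?M (step_pmf q D)) ?E' \<le> (1 - p) * measure_pmf.prob ?M ?E + d"
    proof (rule prob_bind_two_state[OF _ _ d])
      fix x assume "x \<in> set_pmf ?M"
      hence x: "x \<in> carrier_vec n" using set_quantile_rk[OF x0] by blast
      have "p \<le> measure_pmf.prob (step_pmf q D x) {y. t \<le> sq_error y}"
        unfolding p by (rule prob_step_corrupted[OF x q D B t(2)])
      also have "\<dots> \<le> measure_pmf.prob (step_pmf q D x) (- ?E')"
        using le[of "Suc N"] by (intro measure_pmf.finite_measure_mono) auto
      also have "\<dots> = 1 - measure_pmf.prob (step_pmf q D x) ?E'"
        using measure_pmf.prob_compl[of ?E' "step_pmf q D x"] by (simp add: Compl_eq_Diff_UNIV)
      finally show "measure_pmf.prob (step_pmf q D x) ?E' \<le> 1 - p" by simp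
      assume "x \<notin> ?E"
      \<comment> \<open>\<open>prob_step_shrink\<close> is applied with the current threshold
        \<open>(1 - c) ^ N * t\<close> in place of \<open>t\<close>.\<close>
      hence "measure_pmf.prob (step_pmf q D x) {y. sq_error y < (1 - c) * ((1 - c) ^ N * t)} \<le> d"
        unfolding d_def using x c t le[of N] B eps
        by (intro prob_step_shrink) (auto simp: supp_def intro: order_trans)
      thus "measure_pmf.prob (step_pmf q D x) ?E' \<le> d" by (simp add: mult.assoc)
    qed
    also have "\<dots> \<le> (1 - p) * ((1 - p) ^ N + N * d) + d"
      using Suc p1 by (intro add_right_mono mult_left_mono) auto
    \<comment> \<open>The damping of earlier contributions of \<open>d\<close> is given away, so
      they add up linearly.\<close>
    also have "\<dots> \<le> (1 - p) ^ Suc N + Suc N * d"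
    proof -
      have "(1 - p) * (N * d) \<le> N * d" using p0 p1 d by (intro mult_left_le_one_le) auto
      thus ?thesis by (simp add: algebra_simps)
    qed
    finally show ?case by (simp only: add_Suc_right quantile_rk_Suc)
  qed (simp add: measure_pmf.prob_le_1)
qed

end

section \<open>Estimating the probability of no corrupted update\<close>

lemma half_le_floor:
  assumes "1 \<le> (y :: real)"
  shows "y / 2 \<le> real (nat \<lfloor>y\<rfloor>)"
proof -
  have "1 \<le> \<lfloor>y\<rfloor>" using assms by simp
  thus ?thesis by linarith
qed

text \<open>The left side is at most \<open>exp (- (p * (y / 2)))\<close>. For \<open>D = 1\<close>,
  \<open>p = \<beta>\<^sup>2 / 2\<close> gives the first exponential. For larger \<open>D\<close>,
  \<open>Suc D \<le> 2 ^ D\<close> and \<open>(2 / \<beta>) ^ D \<le> T powr c0\<close> give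
  \<open>p \<ge> \<beta> / T powr c0\<close>, hence the second.\<close>

lemma miss_prob_le:
  assumes \<beta>: "0 < \<beta>" "\<beta> < 1" and T: "0 < T" and y: "1 \<le> y" and D: "0 < D"
    and D_le: "real D \<le> max (c0 * ln (real T) / ln (2 / \<beta>)) 1"
  shows "(1 - \<beta> ^ Suc D / Suc D) ^ nat \<lfloor>y\<rfloor>
    \<le> exp (- (\<beta>\<^sup>2 * y / 4)) + exp (- (\<beta> / 2 * (y / T powr c0)))"
proof -
  define p where "p = \<beta> ^ Suc D / Suc D"
  have "\<beta> ^ Suc D \<le> 1" using \<beta> by (intro power_le_one) auto
  hence p: "0 \<le> p" "p \<le> 1" using \<beta> by (auto simp: p_def divide_le_eq)
  have "1 - p \<le> exp (- p)" using exp_ge_add_one_self[of "- p"] by simp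
  hence "(1 - p) ^ nat \<lfloor>y\<rfloor> \<le> exp (- p) ^ nat \<lfloor>y\<rfloor>" using p by (intro power_mono) auto
  also have "\<dots> = exp (- (p * nat \<lfloor>y\<rfloor>))" by (simp add: exp_of_nat_mult[symmetric] mult.commute)
  also have "\<dots> \<le> exp (- (p * (y / 2)))"
    using mult_left_mono[OF half_le_floor[OF y] p(1)] by simp
  also have "\<dots> \<le> exp (- (\<beta>\<^sup>2 * y / 4)) + exp (- (\<beta> / 2 * (y / T powr c0)))"
  proof (cases "D = 1")
    case True
    hence eq: "p * (y / 2) = \<beta>\<^sup>2 * y / 4" by (simp add: p_def power2_eq_square)
    show ?thesis unfolding eq by simp
  next
    case False
    have ln: "0 < ln (2 / \<beta>)" using \<beta> by simp
    \<comment> \<open>As \<open>D\<close> exceeds 1, the maximum must be its first argument.\<close>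
    have "real D \<le> c0 * ln (real T) / ln (2 / \<beta>)" using D_le False D by (auto simp: max_def split: if_splits)
    hence "real D * ln (2 / \<beta>) \<le> c0 * ln (real T)" using ln by (simp add: pos_le_divide_eq)
    hence "exp (real D * ln (2 / \<beta>)) \<le> T powr c0" using T by (simp add: powr_def)
    hence pw: "(2 / \<beta>) ^ D \<le> T powr c0" using \<beta> by (simp add: exp_of_nat_mult)
    have "real (Suc D) \<le> real (2 ^ D)" by (intro of_nat_mono Suc_leI less_exp)
    hence "\<beta> * (\<beta> ^ D / 2 ^ D) \<le> \<beta> * (\<beta> ^ D / Suc D)"
      using \<beta> by (intro mult_left_mono divide_left_mono) simp_all
    moreover have "1 / T powr c0 \<le> \<beta> ^ D / 2 ^ D"
    proof -
      have "1 / T powr c0 \<le> 1 / (2 / \<beta>) ^ D" using pw \<beta> T by (intro divide_left_mono) auto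
      thus ?thesis by (simp add: power_divide)
    qed
    hence "\<beta> * (1 / T powr c0) \<le> \<beta> * (\<beta> ^ D / 2 ^ D)" using \<beta> by (intro mult_left_mono) auto
    ultimately have "\<beta> / T powr c0 \<le> p" by (simp add: p_def)
    hence "(\<beta> / T powr c0) * (y / 2) \<le> p * (y / 2)" using y by (intro mult_right_mono) auto
    hence "exp (- (p * (y / 2))) \<le> exp (- (\<beta> / 2 * (y / T powr c0)))" by (simp add: mult.commute)
    thus ?thesis using exp_ge_zero[of "- (\<beta>\<^sup>2 * y / 4)"] by linarith
  qed
  finally show ?thesis by (simp add: p_def)
qed

theorem theorem3p6:
  fixes C :: real
  assumes "C > 0"
  shows "\<exists>C1 > 0. \<forall>(m :: nat) (n :: nat) (A :: real mat) (xstar :: real vec) (\<epsilon> :: real vec)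
      (b :: real vec) (x0 :: real vec) (\<beta> :: real) (s :: nat) (B :: nat set) (q :: real)
      (T :: nat) (c0 :: real) (D :: nat).
    n \<ge> 2 \<longrightarrow>
    A \<in> carrier_mat m n \<longrightarrow>
    (\<forall>i < m. l2_norm (row A i) = 1) \<longrightarrow>
    (\<forall>q' \<in> {0<..<1}.
       sigma_max A * sqrt (real n) / (sqrt (real m) * sqrt (1 - q')) \<le> C / sqrt (1 - q')) \<longrightarrow>
    0 < \<beta> \<longrightarrow> \<beta> < 1 \<longrightarrow>
    0 < s \<longrightarrow> real s = \<beta> * real m \<longrightarrow>
    xstar \<in> carrier_vec n \<longrightarrow>
    \<epsilon> \<in> carrier_vec m \<longrightarrow>
    sparse s \<epsilon> \<longrightarrow>
    B = supp \<epsilon> \<longrightarrow>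
    s \<le> card B \<longrightarrow>
    b = A *\<^sub>v xstar + \<epsilon> \<longrightarrow>
    0 < q \<longrightarrow> q < 1 \<longrightarrow>
    x0 \<in> carrier_vec n \<longrightarrow>
    int T \<ge> \<lceil>real n / ln (real n)\<rceil> \<longrightarrow>
    0 < c0 \<longrightarrow> c0 < 1 \<longrightarrow>
    0 < D \<longrightarrow> real D \<le> max (c0 * ln (real T) / ln (2 / \<beta>)) 1 \<longrightarrow>
    measure_pmf.prob (quantile_rk A b q D x0 T)
      {x. (l2_norm (x - xstar))\<^sup>2
            \<ge> 0.99 ^ nat \<lfloor>real n / ln (real n)\<rfloor> * (MIN i\<in>B. \<bar>\<epsilon> $ i\<bar>\<^sup>2)}
    \<ge> 1 - C1 / ln (real n)
        - exp (- (\<beta>\<^sup>2 * real n / (4 * ln (real n))))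
        - exp (- (\<beta> / 2 * (real n / (real T powr c0 * ln (real n)))))"
proof (rule exI[of _ "100 * C\<^sup>2"], intro conjI allI impI)
  \<comment> \<open>The factor 100 is \<open>1 / c\<close> for the loss \<open>c = 1 / 100\<close>
    per step that 0.99 allows.\<close>
  show "100 * C\<^sup>2 > 0" using assms by simp
next
  fix m n :: nat and A :: "real mat" and xstar \<epsilon> b x0 :: "real vec" and \<beta> :: real and s :: nat
    and B :: "nat set" and q :: real and T :: nat and c0 :: real and D :: nat
  assume n: "n \<ge> 2" and A: "A \<in> carrier_mat m n" and unit: "\<forall>i < m. l2_norm (row A i) = 1"
    and sigma: "\<forall>q' \<in> {0<..<1}.
       sigma_max A * sqrt (real n) / (sqrt (real m) * sqrt (1 - q')) \<le> C / sqrt (1 - q')"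
    and \<beta>: "0 < \<beta>" "\<beta> < 1" and s: "0 < s" "real s = \<beta> * real m"
    and xstar: "xstar \<in> carrier_vec n" and eps: "\<epsilon> \<in> carrier_vec m"
    and sparse: "sparse s \<epsilon>" and B: "B = supp \<epsilon>" "s \<le> card B"
    and b: "b = A *\<^sub>v xstar + \<epsilon>" and q: "0 < q" "q < 1" and x0: "x0 \<in> carrier_vec n"
    and T: "int T \<ge> \<lceil>real n / ln (real n)\<rceil>"
    and D: "0 < D" "real D \<le> max (c0 * ln (real T) / ln (2 / \<beta>)) 1"
  have m: "0 < m" using s by (cases m) auto
  interpret sys: noisy_system A m n xstar \<epsilon> b
    by unfold_locales (use A unit xstar eps b m n in auto)
  define y where "y = real n / ln (real n)"
  define N where "N = nat \<lfloor>y\<rfloor>"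
  define t where "t = (MIN i\<in>B. \<bar>\<epsilon> $ i\<bar>\<^sup>2)"
  define d where "d = (sigma_max A)\<^sup>2 / ((1 / 100) * m)"
  have ln: "0 < ln (real n)" using n by simp
  have y1: "1 \<le> y"
    using ln_le_minus_one[of "real n"] n ln by (simp add: y_def)
  have NT: "N \<le> T" and T0: "0 < T" using T y1 unfolding N_def y_def[symmetric] by linarith+
  \<comment> \<open>Equality makes a uniform row corrupted with probability exactly
    \<open>\<beta>\<close> and the minimum range over a nonempty set.\<close>
  have cardB: "card B = s" using sparse B by (simp add: sparse_def)
  have finB: "finite B" using cardB s(1) card_ge_0_finite by metis
  have neB: "B \<noteq> {}" using cardB s(1) by auto
  have t_le: "t \<le> (\<epsilon> $ i)\<^sup>2" if "i \<in> supp \<epsilon>" for i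
    unfolding t_def using finB B that by (auto intro!: Min_le)
  have t0: "0 \<le> t" unfolding t_def using finB neB by (subst Min_ge_iff) auto
  have \<beta>_eq: "card (supp \<epsilon>) / m = \<beta>" using cardB B s m by simp
  have Nd: "N * d \<le> 100 * C\<^sup>2 / ln (real n)"
  proof -
    \<comment> \<open>The factor \<open>sqrt (1 - q')\<close> cancels, so any \<open>q'\<close>
      gives the same information.\<close>
    have "sigma_max A * sqrt (real n) / (sqrt (real m) * sqrt (1 - 1 / 2)) \<le> C / sqrt (1 - 1 / 2)"
      using sigma by (rule bspec) simp
    hence "sigma_max A * sqrt (real n) \<le> C * sqrt (real m)"
      using m by (simp add: field_simps)
    hence "(sigma_max A * sqrt (real n))\<^sup>2 \<le> (C * sqrt (real m))\<^sup>2"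
      using sigma_max_bound(1)[OF A _ xstar] n by (intro power_mono) auto
    hence "(sigma_max A)\<^sup>2 * n \<le> C\<^sup>2 * m" by (simp add: power_mult_distrib)
    hence "d \<le> 100 * C\<^sup>2 / n" using m n by (simp add: d_def field_simps)
    moreover have "real N \<le> y" using y1 by (simp add: N_def)
    ultimately have "N * d \<le> y * (100 * C\<^sup>2 / n)"
      using y1 by (intro mult_mono) (auto simp: d_def)
    also have "\<dots> = 100 * C\<^sup>2 / ln (real n)" using n by (simp add: y_def)
    finally show ?thesis .
  qed
  let ?Q = "quantile_rk A b q D x0 T"
  let ?E = "{x. sys.sq_error x < (1 - 1 / 100) ^ N * t}"
  \<comment> \<open>Only the last \<open>N\<close> of the \<open>T\<close> steps are
    analysed.\<close>
  have "measure_pmf.prob (quantile_rk A b q D x0 (T - N + N)) ?E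
      \<le> (1 - \<beta> ^ Suc D / Suc D) ^ N + N * d"
    unfolding d_def
    by (rule sys.prob_sq_error_small[OF x0 q D(1) t0 t_le]) (auto simp: \<beta>_eq)
  hence "measure_pmf.prob ?Q ?E \<le> (1 - \<beta> ^ Suc D / Suc D) ^ N + N * d" using NT by simp
  also have "\<dots> \<le> exp (- (\<beta>\<^sup>2 * y / 4)) + exp (- (\<beta> / 2 * (y / T powr c0))) + 100 * C\<^sup>2 / ln (real n)"
    unfolding N_def using miss_prob_le[OF \<beta> T0 y1 D] Nd N_def by (intro add_mono) auto
  finally have "1 - measure_pmf.prob ?Q ?E \<ge> 1 - 100 * C\<^sup>2 / ln (real n)
      - exp (- (\<beta>\<^sup>2 * y / 4)) - exp (- (\<beta> / 2 * (y / T powr c0)))"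
    by linarith
  also have "1 - measure_pmf.prob ?Q ?E = measure_pmf.prob ?Q (- ?E)"
    using measure_pmf.prob_compl[of ?E ?Q] by (simp add: Compl_eq_Diff_UNIV)
  also have "- ?E = {x. (l2_norm (x - xstar))\<^sup>2 \<ge> 0.99 ^ N * t}"
    by (auto simp: sys.sq_error_def l2_norm_sq not_less)
  finally show "measure_pmf.prob ?Q
      {x. (l2_norm (x - xstar))\<^sup>2
            \<ge> 0.99 ^ nat \<lfloor>real n / ln (real n)\<rfloor> * (MIN i\<in>B. \<bar>\<epsilon> $ i\<bar>\<^sup>2)}
    \<ge> 1 - 100 * C\<^sup>2 / ln (real n)
        - exp (- (\<beta>\<^sup>2 * real n / (4 * ln (real n))))
        - exp (- (\<beta> / 2 * (real n / (real T powr c0 * ln (real n)))))"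
    by (simp add: N_def y_def t_def mult.commute)
qed

end
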